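(* Let $(R,\mu)$ be a $\sigma$-finite nonatomic measure space with $\mu(R)=\infty$. Let $p_1,p_2,q_1,q_2\in(0,\infty]$ be such that either $p_j<\infty$ or $p_j=q_j=\infty$ for $j=1,2$. Then $$L^{p_1,q_1}(R,\mu)\overset{*}{\underset{\infty}{\hookrightarrow}}L^{p_2,q_2}(R,\mu)$$ holds if and only if $p_1<p_2$.
   Context: All sets $E\subseteq R$ are understood to be $\mu$-measurable. The nonincreasing rearrangement of a $\mu$-measurable $f$ on $R$ is $f^*(t)=\inf\{\lambda\ge0:\mu(\{x\in R:|f(x)|>\lambda\})\le t\}$, $t\in[0,\infty)$. The Lorentz functional is $\|f\|_{L^{p,q}(R,\mu)}=\|t^{\frac1p-\frac1q}f^*(t)\|_{L^q(0,\infty)}$ (with $1/\infty=0$), and $L^{p,q}(R,\mu)$ is the set of $\mu$-measurable $f$ with $\|f\|_{L^{p,q}(R,\mu)}<\infty$; for $p<\infty$ or $p=q=\infty$ it is a quasi-normed space. For such function spaces $X,Y$ over $(R,\mu)$, write $X\overset{*}{\underset{\infty}{\hookrightarrow}}Y$ if $$\lim_{a\to\infty}\sup_{\|f\|_X\le1}\ \inf_{E\subseteq R,\ \mu(E)\le a}\|f\chi_{R\setminus E}\|_Y=0.$$ *)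

theory Defs
  imports "HOL-Probability.Essential_Supremum"
begin

definition nonatomic :: "'a measure \<Rightarrow> bool" where
  "nonatomic M \<longleftrightarrow>
    (\<forall>A\<in>sets M. emeasure M A > 0 \<longrightarrow>
      (\<exists>B\<in>sets M. B \<subseteq> A \<and> 0 < emeasure M B \<and> emeasure M B < emeasure M A))"

(* Nonnegative values are taken in [0,\<infinity>]; in particular the infimum over the empty set is \<infinity>. *)
definition rearrangement :: "'a measure \<Rightarrow> ('a \<Rightarrow> 'b::real_normed_vector) \<Rightarrow> real \<Rightarrow> ennreal" where
  "rearrangement M f t =
    (INF l\<in>{l::real. 0 \<le> l \<and> emeasure M {x \<in> space M. norm (f x) > l} \<le> ennreal t}. ennreal l)"

(* Only used for r > 0. *)
definition ennreal_powr :: "ennreal \<Rightarrow> real \<Rightarrow> ennreal" where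
  "ennreal_powr x r = (if x = \<infinity> then \<infinity> else ennreal (enn2real x powr r))"

definition Lq_norm :: "ennreal \<Rightarrow> (real \<Rightarrow> ennreal) \<Rightarrow> ennreal" where
  "Lq_norm q g =
    (if q = \<infinity> then esssup (restrict_space lborel {0<..}) g
     else ennreal_powr (\<integral>\<^sup>+ t\<in>{0<..}. ennreal_powr (g t) (enn2real q) \<partial>lborel) (1 / enn2real q))"

(* On ennreal, 1 / \<infinity> = 0, so the exponent below is 1/p - 1/q for all p, q in (0,\<infinity>]. *)
definition lorentz_norm ::
    "'a measure \<Rightarrow> ennreal \<Rightarrow> ennreal \<Rightarrow> ('a \<Rightarrow> 'b::real_normed_vector) \<Rightarrow> ennreal" where
  "lorentz_norm M p q f =
    Lq_norm q (\<lambda>t. ennreal (t powr (enn2real (1 / p) - enn2real (1 / q))) * rearrangement M f t)"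

(* A function space over M is represented by its functional X on measurable functions, with value
   \<infinity> off the space, so that X f \<le> 1 includes membership. *)
definition star_embedded_at_infinity ::
    "'a measure \<Rightarrow> (('a \<Rightarrow> 'b::real_normed_vector) \<Rightarrow> ennreal) \<Rightarrow> (('a \<Rightarrow> 'b) \<Rightarrow> ennreal) \<Rightarrow> bool" where
  "star_embedded_at_infinity M X Y \<longleftrightarrow>
    ((\<lambda>a::real. SUP f\<in>{f \<in> borel_measurable M. X f \<le> 1}.
        INF E\<in>{E \<in> sets M. emeasure M E \<le> ennreal a}.
          Y (\<lambda>x. indicator (space M - E) x *\<^sub>R f x)) \<longlongrightarrow> 0) at_top"

end

theory Submission
  imports Defs
begin

text \<open>
  A plateau argument shows that f in the unit ball of L^{p1,q1} satisfies f*(t) < C t^{-1/p1}.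
  If p1 < p2, removing the set where |f| exceeds l = C a^{-1/p1}, which has measure at most a,
  leaves a function whose rearrangement is at most l min(1, (t/a)^{-1/p1}); its L^{p2,q2} norm
  is of order a^{1/p2 - 1/p1}, which tends to 0.
  If p1 \<ge> p2, normalised indicators of sets of finite measure m = 2a defeat the embedding: after
  removing measure at most a, at least half of the set remains, and the remaining norm is bounded
  below by a multiple of m^{1/p2 - 1/p1} \<ge> 1.
\<close>

section \<open>Order and measurability properties of the rearrangement\<close>

lemma rearrangement_le:
  assumes "0 \<le> l" "emeasure M {x \<in> space M. norm (f x) > l} \<le> ennreal t"
  shows "rearrangement M f t \<le> ennreal l"
  unfolding rearrangement_def using assms by (intro INF_lower) auto

lemma rearrangement_ge:
  assumes "\<And>l. 0 \<le> l \<Longrightarrow> l < c \<Longrightarrow> ennreal t < emeasure M {x \<in> space M. norm (f x) > l}"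
  shows "ennreal c \<le> rearrangement M f t"
  unfolding rearrangement_def
proof (intro INF_greatest)
  fix l assume "l \<in> {l. 0 \<le> l \<and> emeasure M {x \<in> space M. norm (f x) > l} \<le> ennreal t}"
  then have "\<not> l < c"
    using assms[of l] by (auto simp flip: not_le)
  then show "ennreal c \<le> ennreal l"
    by (simp add: ennreal_leI)
qed

text \<open>The infimum defining the rearrangement need not be attained a priori; strictness of the
  inequality yields an admissible level below \<open>l\<close>, and superlevel sets shrink as the
  level rises.\<close>

lemma emeasure_superlevel_le:
  assumes [measurable]: "f \<in> borel_measurable M" and "rearrangement M f t < ennreal l"
  shows "emeasure M {x \<in> space M. norm (f x) > l} \<le> ennreal t"
proof -
  obtain l' where l': "emeasure M {x \<in> space M. norm (f x) > l'} \<le> ennreal t" "ennreal l' < ennreal l" "0 \<le> l'"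
    using assms(2) unfolding rearrangement_def INF_less_iff by auto
  then have "l' < l"
    by (simp add: ennreal_less_iff)
  then have "emeasure M {x \<in> space M. norm (f x) > l} \<le> emeasure M {x \<in> space M. norm (f x) > l'}"
    by (intro emeasure_mono) auto
  with l' show ?thesis
    by simp
qed

lemma rearrangement_antimono:
  assumes "s \<le> t"
  shows "rearrangement M f t \<le> rearrangement M f s"
  unfolding rearrangement_def using assms
  by (intro INF_superset_mono) (auto intro: order.trans ennreal_leI)

lemma rearrangement_mono_norm:
  assumes [measurable]: "f \<in> borel_measurable M" and "\<And>x. x \<in> space M \<Longrightarrow> norm (g x) \<le> norm (f x)"
  shows "rearrangement M g t \<le> rearrangement M f t"
  unfolding rearrangement_def
proof (rule INF_superset_mono)
  have "emeasure M {x \<in> space M. norm (g x) > l} \<le> emeasure M {x \<in> space M. norm (f x) > l}" for l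
    using assms(2) by (intro emeasure_mono) (force, measurable)
  then show "{l. 0 \<le> l \<and> emeasure M {x \<in> space M. norm (f x) > l} \<le> ennreal t}
      \<subseteq> {l. 0 \<le> l \<and> emeasure M {x \<in> space M. norm (g x) > l} \<le> ennreal t}"
    by (auto intro: order.trans)
qed simp

text \<open>Every strict superlevel set of a nonincreasing function is downward closed, hence an
  interval.\<close>

lemma borel_measurable_antimono_ennreal:
  fixes f :: "real \<Rightarrow> ennreal"
  assumes "antimono f"
  shows "f \<in> borel_measurable borel"
proof (rule borel_measurableI_greater)
  fix y
  have "{x. y < f x} \<in> sets borel"
    using assms
    by (intro real_interval_borel_measurable) (auto simp: is_interval_1 antimono_def intro: less_le_trans)
  then show "{x \<in> space borel. y < f x} \<in> sets borel"
    by simp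
qed

text \<open>The variable ranges over all reals: \<open>ennreal t\<close> is 0 for negative
  \<open>t\<close>, so the rearrangement is constant there and stays nonincreasing on the whole
  line.\<close>

lemma borel_measurable_rearrangement [measurable]: "rearrangement M f \<in> borel_measurable borel"
  by (intro borel_measurable_antimono_ennreal antimonoI rearrangement_antimono)

section \<open>Powers of extended nonnegative numbers and integrals of power functions\<close>

lemma ennreal_powr_ennreal: "0 \<le> x \<Longrightarrow> ennreal_powr (ennreal x) r = ennreal (x powr r)"
  by (simp add: ennreal_powr_def)

lemma ennreal_powr_mono:
  assumes "x \<le> y" "0 \<le> r"
  shows "ennreal_powr x r \<le> ennreal_powr y r"
  using assms by (cases x; cases y) (auto simp: ennreal_powr_def top_unique intro!: ennreal_leI powr_mono2)

lemma nn_integral_powr_from_0: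
  fixes \<alpha> a :: real
  assumes "0 < \<alpha>" "0 \<le> a"
  shows "(\<integral>\<^sup>+t. ennreal (t powr (\<alpha> - 1)) * indicator {0..a} t \<partial>lborel) = ennreal (a powr \<alpha> / \<alpha>)"
proof -
  have "((\<lambda>t. t powr (\<alpha> - 1)) has_integral (a powr (\<alpha> - 1 + 1) / (\<alpha> - 1 + 1))) {0..a}"
    using assms by (intro has_integral_powr_from_0) auto
  then have "((\<lambda>t. t powr (\<alpha> - 1) * indicator {0..a} t) has_integral (a powr \<alpha> / \<alpha>)) UNIV"
    by (subst (asm) has_integral_restrict_UNIV[symmetric])
      (auto elim!: has_integral_eq[rotated])
  then have "(\<integral>\<^sup>+t. ennreal (t powr (\<alpha> - 1) * indicator {0..a} t) \<partial>lborel) = ennreal (a powr \<alpha> / \<alpha>)"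
    by (intro nn_integral_has_integral_lborel) auto
  then show ?thesis
    by (simp add: ennreal_mult' ennreal_indicator)
qed

text \<open>The antiderivative \<open>- (t powr (- \<beta>) / \<beta>)\<close> tends to 0 at
  infinity, so only its value at \<open>a\<close> contributes. This is the tail counterpart of
  \<open>nn_integral_powr_from_0\<close>.\<close>

lemma nn_integral_powr_to_infinity:
  fixes \<beta> a :: real
  assumes "0 < \<beta>" "0 < a"
  shows "(\<integral>\<^sup>+t. ennreal (t powr (- \<beta> - 1)) * indicator {a..} t \<partial>lborel) = ennreal (a powr (- \<beta>) / \<beta>)"
proof -
  have "(\<integral>\<^sup>+t. ennreal (t powr (- \<beta> - 1)) * indicator {a..} t \<partial>lborel)
      = ennreal (0 - (- (a powr (- \<beta>) / \<beta>)))"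
  proof (rule nn_integral_FTC_atLeast)
    show "((\<lambda>t. - (t powr (- \<beta>) / \<beta>)) has_field_derivative t powr (- \<beta> - 1)) (at t)" if "a \<le> t" for t
      using assms that by (auto intro!: derivative_eq_intros simp: powr_diff field_simps)
    have "((\<lambda>t. - (t powr (- \<beta>) / \<beta>)) \<longlongrightarrow> - (0 / \<beta>)) at_top"
      using assms by (intro tendsto_intros tendsto_neg_powr filterlim_ident) auto
    then show "((\<lambda>t. - (t powr (- \<beta>) / \<beta>)) \<longlongrightarrow> 0) at_top"
      by simp
  qed auto
  then show ?thesis
    by simp
qed

section \<open>Lorentz norm bounds obtained from bounds on the rearrangement\<close>

text \<open>Positivity rules out \<open>1 / 0 = \<infinity>\<close>, which \<open>enn2real\<close>
  would send to 0 and thus confuse with \<open>1 / \<infinity>\<close>.\<close>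

lemma enn2real_inverse_less_iff:
  fixes p q :: ennreal
  assumes "0 < p" "0 < q"
  shows "enn2real (1 / q) < enn2real (1 / p) \<longleftrightarrow> p < q"
  using assms
  by (cases p; cases q)
    (auto simp: divide_ennreal[of 1, simplified] ennreal_less_iff frac_less2 top_unique
      divide_simps split: if_splits)

text \<open>The profile is flat up to \<open>a\<close> and then decays faster than
  \<open>t powr (- 1/p)\<close>, so it has finite norm, and rescaling \<open>t\<close> by
  \<open>a\<close> produces the factor \<open>a powr (1/p)\<close>. The \<open>obtains\<close> form
  makes \<open>K\<close> depend on \<open>p\<close>, \<open>q\<close>, \<open>s\<close> only,
  uniformly in the measure, the function, \<open>c\<close> and \<open>a\<close>.\<close>

lemma lorentz_norm_le_profile:
  fixes p q :: ennreal and s :: real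
  assumes p: "0 < p" and q: "0 < q" and pq: "p < \<infinity> \<or> q = \<infinity>" and s: "enn2real (1 / p) < s"
  obtains K where "0 < K"
    "\<And>(M :: 'a measure) (f :: 'a \<Rightarrow> 'b::real_normed_vector) c a. 0 \<le> c \<Longrightarrow> 0 < a \<Longrightarrow>
      (\<And>t. 0 < t \<Longrightarrow> rearrangement M f t \<le> ennreal (c * min 1 ((t / a) powr (- s)))) \<Longrightarrow>
      lorentz_norm M p q f \<le> ennreal (K * c * a powr enn2real (1 / p))"
proof (cases "q = \<infinity>")
  case True
  define r where "r = enn2real (1 / p)"
  have r: "0 \<le> r" "r < s"
    using s by (auto simp: r_def)
  show ?thesis
  proof (rule that[of 1])
    fix M :: "'a measure" and f :: "'a \<Rightarrow> 'b" and c a :: real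
    assume c: "0 \<le> c" and a: "0 < a"
      and f: "\<And>t. 0 < t \<Longrightarrow> rearrangement M f t \<le> ennreal (c * min 1 ((t / a) powr (- s)))"
    \<comment> \<open>The weight does not decrease up to \<open>a\<close>, and past \<open>a\<close>
      the decay of order \<open>s > r\<close> outweighs it, so the product is largest at
      \<open>t = a\<close>.\<close>
    have weight: "t powr r * min 1 ((t / a) powr (- s)) \<le> a powr r" if t: "0 < t" for t
    proof (cases "t \<le> a")
      case True
      have "t powr r * min 1 ((t / a) powr (- s)) \<le> t powr r * 1"
        by (intro mult_left_mono) auto
      also have "\<dots> \<le> a powr r"
        using True t r by (simp add: powr_mono2)
      finally show ?thesis .
    next
      case False
      have "t powr r * min 1 ((t / a) powr (- s)) \<le> t powr r * (t / a) powr (- r)"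
        using False t a r by (intro mult_left_mono min.coboundedI2 powr_mono) (auto simp: field_simps)
      also have "\<dots> = a powr r"
        using t a by (simp add: powr_divide powr_minus field_simps)
      finally show ?thesis .
    qed
    have "ennreal (t powr r) * rearrangement M f t \<le> ennreal (c * a powr r)" if t: "0 < t" for t
    proof -
      have "ennreal (t powr r) * rearrangement M f t \<le> ennreal (t powr r) * ennreal (c * min 1 ((t / a) powr (- s)))"
        using f[OF t] by (intro mult_left_mono) auto
      also have "\<dots> = ennreal (c * (t powr r * min 1 ((t / a) powr (- s))))"
        using c by (simp add: ennreal_mult'[symmetric] mult_ac)
      also have "\<dots> \<le> ennreal (c * a powr r)"
        using c weight[OF t] by (intro ennreal_leI mult_left_mono)
      finally show ?thesis .
    qed
    then show "lorentz_norm M p q f \<le> ennreal (1 * c * a powr enn2real (1 / p))"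
      unfolding lorentz_norm_def Lq_norm_def using True
      by (auto simp: r_def[symmetric] intro!: esssup_I measurable_restrict_space1 AE_I2)
  qed simp
next
  case False
  define r where "r = enn2real (1 / p)"
  define Q where "Q = enn2real q"
  have Q: "0 < Q" "enn2real (1 / q) = 1 / Q"
    using False q unfolding Q_def by (cases q; simp add: divide_ennreal[of 1, simplified])+
  \<comment> \<open>For finite \<open>q\<close> the condition \<open>pq\<close> forces
    \<open>p < \<infinity>\<close>, hence a positive \<open>r\<close>; this gives integrability at
    0.\<close>
  have r: "0 < r" "r < s"
    using s p pq False by (auto simp: r_def enn2real_positive_iff ennreal_zero_less_divide less_top[symmetric] ennreal_divide_eq_top_iff)
  \<comment> \<open>After raising to the power \<open>Q\<close>, the integrand behaves like
    \<open>t powr (\<alpha> - 1)\<close> on the flat part and like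
    \<open>t powr (- \<beta> - 1)\<close> on the tail.\<close>
  define \<alpha> where "\<alpha> = r * Q"
  define \<beta> where "\<beta> = (s - r) * Q"
  have ab: "0 < \<alpha>" "0 < \<beta>"
    using r Q by (auto simp: \<alpha>_def \<beta>_def)
  show ?thesis
  proof (rule that[of "(1 / \<alpha> + 1 / \<beta>) powr (1 / Q)"])
    show "0 < (1 / \<alpha> + 1 / \<beta>) powr (1 / Q)"
      using ab add_pos_pos[of "1 / \<alpha>" "1 / \<beta>"] by simp
  next
    fix M :: "'a measure" and f :: "'a \<Rightarrow> 'b" and c a :: real
    assume c: "0 \<le> c" and a: "0 < a"
      and f: "\<And>t. 0 < t \<Longrightarrow> rearrangement M f t \<le> ennreal (c * min 1 ((t / a) powr (- s)))"
    let ?g = "\<lambda>t. ennreal (t powr (r - 1 / Q)) * rearrangement M f t"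
    \<comment> \<open>The first summand dominates for \<open>t \<le> a\<close>, the second for
      \<open>t > a\<close>. Adding both gives one pointwise majorant, so the integral itself need
      not be split.\<close>
    have *: "ennreal_powr (?g t) Q * indicator {0<..} t
        \<le> ennreal (c powr Q) * (ennreal (t powr (\<alpha> - 1)) * indicator {0..a} t)
          + ennreal (c powr Q * a powr (s * Q)) * (ennreal (t powr (- \<beta> - 1)) * indicator {a..} t)" for t
    proof (cases "0 < t")
      case t: True
      have "?g t \<le> ennreal (t powr (r - 1 / Q)) * ennreal (c * min 1 ((t / a) powr (- s)))"
        using f[OF t] by (intro mult_left_mono) auto
      also have "\<dots> = ennreal (t powr (r - 1 / Q) * (c * min 1 ((t / a) powr (- s))))"
        using c by (simp add: ennreal_mult')
      finally have "ennreal_powr (?g t) Q \<le> ennreal_powr (ennreal (t powr (r - 1 / Q) * (c * min 1 ((t / a) powr (- s))))) Q"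
        using Q by (intro ennreal_powr_mono) auto
      also have "\<dots> = ennreal (t powr (\<alpha> - 1) * c powr Q * (min 1 ((t / a) powr (- s))) powr Q)"
        using c Q by (subst ennreal_powr_ennreal)
          (auto simp: powr_mult powr_powr \<alpha>_def algebra_simps)
      finally have le: "ennreal_powr (?g t) Q \<le> \<dots>" .
      show ?thesis
      proof (cases "t \<le> a")
        case True
        have "t powr (\<alpha> - 1) * c powr Q * (min 1 ((t / a) powr (- s))) powr Q \<le> t powr (\<alpha> - 1) * c powr Q * 1"
          using Q by (intro mult_left_mono powr_le1) auto
        then have "ennreal_powr (?g t) Q \<le> ennreal (c powr Q) * ennreal (t powr (\<alpha> - 1))"
          by (intro order.trans[OF le]) (simp add: ennreal_mult'[symmetric] mult_ac ennreal_leI)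
        then show ?thesis
          using t True by (auto intro!: add_increasing2)
      next
        case False
        have "t powr (\<alpha> - 1) * c powr Q * (min 1 ((t / a) powr (- s))) powr Q
            \<le> t powr (\<alpha> - 1) * c powr Q * ((t / a) powr (- s)) powr Q"
          using Q by (intro mult_left_mono powr_mono2) auto
        also have "\<dots> = c powr Q * a powr (s * Q) * (t powr (\<alpha> - 1) * t powr (- (s * Q)))"
          using t a by (simp add: powr_powr powr_divide powr_minus field_simps)
        also have "t powr (\<alpha> - 1) * t powr (- (s * Q)) = t powr (- \<beta> - 1)"
          by (simp add: powr_add[symmetric] \<alpha>_def \<beta>_def algebra_simps)
        finally have "ennreal_powr (?g t) Q \<le> ennreal (c powr Q * a powr (s * Q)) * ennreal (t powr (- \<beta> - 1))"
          by (intro order.trans[OF le]) (simp add: ennreal_mult'[symmetric] ennreal_leI)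
        then show ?thesis
          using t False by (auto intro!: add_increasing)
      qed
    qed simp
    have "(\<integral>\<^sup>+ t\<in>{0<..}. ennreal_powr (?g t) Q \<partial>lborel)
        \<le> (\<integral>\<^sup>+ t. ennreal (c powr Q) * (ennreal (t powr (\<alpha> - 1)) * indicator {0..a} t)
          + ennreal (c powr Q * a powr (s * Q)) * (ennreal (t powr (- \<beta> - 1)) * indicator {a..} t) \<partial>lborel)"
      by (intro nn_integral_mono *)
    also have "\<dots> = ennreal (c powr Q) * ennreal (a powr \<alpha> / \<alpha>)
        + ennreal (c powr Q * a powr (s * Q)) * ennreal (a powr (- \<beta>) / \<beta>)"
      using ab a by (simp add: nn_integral_add nn_integral_cmult nn_integral_powr_from_0 nn_integral_powr_to_infinity)
    also have "\<dots> = ennreal (c powr Q * (a powr \<alpha> / \<alpha>) + c powr Q * (a powr (s * Q) * a powr (- \<beta>)) / \<beta>)"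
      using ab by (simp add: ennreal_mult'[symmetric] ennreal_plus[symmetric] mult_ac del: ennreal_plus)
    also have "a powr (s * Q) * a powr (- \<beta>) = a powr \<alpha>"
      by (simp add: powr_add[symmetric] \<alpha>_def \<beta>_def algebra_simps)
    also have "c powr Q * (a powr \<alpha> / \<alpha>) + c powr Q * a powr \<alpha> / \<beta> = (1 / \<alpha> + 1 / \<beta>) * c powr Q * a powr \<alpha>"
      by (simp add: algebra_simps)
    finally have "ennreal_powr (\<integral>\<^sup>+ t\<in>{0<..}. ennreal_powr (?g t) Q \<partial>lborel) (1 / Q)
        \<le> ennreal_powr (ennreal ((1 / \<alpha> + 1 / \<beta>) * c powr Q * a powr \<alpha>)) (1 / Q)"
      using Q by (intro ennreal_powr_mono) auto
    also have "\<dots> = ennreal ((1 / \<alpha> + 1 / \<beta>) powr (1 / Q) * c * a powr r)"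
      using ab Q c by (subst ennreal_powr_ennreal) (auto simp: powr_mult powr_powr \<alpha>_def)
    finally show "lorentz_norm M p q f \<le> ennreal ((1 / \<alpha> + 1 / \<beta>) powr (1 / Q) * c * a powr enn2real (1 / p))"
      unfolding lorentz_norm_def Lq_norm_def using False Q by (simp add: r_def[symmetric] Q_def[symmetric])
  qed
qed

text \<open>Only the interval from 0 to \<open>a\<close> is kept; there the norm is at least that of
  the constant \<open>c\<close>, which scales like \<open>c * a powr (1/p)\<close>. Again
  \<open>K\<close> depends on \<open>p\<close> and \<open>q\<close> only.\<close>

lemma lorentz_norm_ge_plateau:
  fixes p q :: ennreal
  assumes p: "0 < p" and q: "0 < q" and pq: "p < \<infinity> \<or> q = \<infinity>"
  obtains K where "0 < K"
    "\<And>(M :: 'a measure) (f :: 'a \<Rightarrow> 'b::real_normed_vector) c a. 0 \<le> c \<Longrightarrow> 0 < a \<Longrightarrow>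
      (\<And>t. 0 < t \<Longrightarrow> t \<le> a \<Longrightarrow> ennreal c \<le> rearrangement M f t) \<Longrightarrow>
      ennreal (K * c * a powr enn2real (1 / p)) \<le> lorentz_norm M p q f"
proof (cases "q = \<infinity>")
  case True
  define r where "r = enn2real (1 / p)"
  have r: "0 \<le> r"
    by (auto simp: r_def)
  show ?thesis
  proof (rule that[of "(1 / 2) powr r"])
    fix M :: "'a measure" and f :: "'a \<Rightarrow> 'b" and c a :: real
    assume c: "0 \<le> c" and a: "0 < a"
      and f: "\<And>t. 0 < t \<Longrightarrow> t \<le> a \<Longrightarrow> ennreal c \<le> rearrangement M f t"
    let ?g = "\<lambda>t. ennreal (t powr r) * rearrangement M f t"
    let ?S = "esssup (restrict_space lborel {0<..}) ?g"
    have *: "AE t in lborel. t \<in> {0<..} \<longrightarrow> ?g t \<le> ?S"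
      using esssup_AE[of ?g "restrict_space lborel {0<..}"] by (simp add: AE_restrict_space_iff)
    \<comment> \<open>The essential supremum bounds \<open>?g\<close> only almost everywhere, but
      the exceptional null set cannot contain an interval of length \<open>a / 2\<close>. Taking
      \<open>t > a / 2\<close> instead of \<open>t = a\<close> costs the factor
      \<open>(1 / 2) powr r\<close>.\<close>
    obtain t where t: "a / 2 < t" "t < a" "?g t \<le> ?S"
    proof (rule ccontr)
      assume "\<not> thesis"
      with that have "\<not> ?g t \<le> ?S" if "t \<in> {a / 2<..<a}" for t
        using \<open>t \<in> {a / 2<..<a}\<close> by fastforce
      then have "AE t in lborel. t \<notin> {a / 2<..<a}"
        using a by (intro eventually_mono[OF *]) force
      then have "emeasure lborel {a / 2<..<a} = 0"
        by (subst (asm) AE_iff_measurable[of "{a / 2<..<a}"]) auto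
      then show False
        using a by simp
    qed
    have "(1 / 2) powr r * c * a powr r = (a / 2) powr r * c"
      using a by (simp add: powr_divide)
    also have "\<dots> \<le> t powr r * c"
      using t a c r by (intro mult_right_mono powr_mono2) auto
    finally have "ennreal ((1 / 2) powr r * c * a powr r) \<le> ennreal (t powr r) * ennreal c"
      by (simp add: ennreal_mult'[symmetric] ennreal_leI)
    also have "\<dots> \<le> ?g t"
      using t a by (intro mult_left_mono f) auto
    finally show "ennreal ((1 / 2) powr r * c * a powr enn2real (1 / p)) \<le> lorentz_norm M p q f"
      unfolding lorentz_norm_def Lq_norm_def using True t by (simp add: r_def[symmetric])
  qed simp
next
  case False
  define r where "r = enn2real (1 / p)"
  define Q where "Q = enn2real q"
  have Q: "0 < Q" "enn2real (1 / q) = 1 / Q"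
    using False q unfolding Q_def by (cases q; simp add: divide_ennreal[of 1, simplified])+
  have r: "0 < r"
    using p pq False by (auto simp: r_def enn2real_positive_iff ennreal_zero_less_divide less_top[symmetric] ennreal_divide_eq_top_iff)
  define \<alpha> where "\<alpha> = r * Q"
  have \<alpha>: "0 < \<alpha>"
    using r Q by (auto simp: \<alpha>_def)
  show ?thesis
  proof (rule that[of "(1 / \<alpha>) powr (1 / Q)"])
    show "0 < (1 / \<alpha>) powr (1 / Q)"
      using \<alpha> by simp
  next
    fix M :: "'a measure" and f :: "'a \<Rightarrow> 'b" and c a :: real
    assume c: "0 \<le> c" and a: "0 < a"
      and f: "\<And>t. 0 < t \<Longrightarrow> t \<le> a \<Longrightarrow> ennreal c \<le> rearrangement M f t"
    let ?g = "\<lambda>t. ennreal (t powr (r - 1 / Q)) * rearrangement M f t"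
    have *: "ennreal (c powr Q) * (ennreal (t powr (\<alpha> - 1)) * indicator {0..a} t)
        \<le> ennreal_powr (?g t) Q * indicator {0<..} t" for t
    proof (cases "0 < t \<and> t \<le> a")
      case True
      have "ennreal (c powr Q) * ennreal (t powr (\<alpha> - 1)) = ennreal_powr (ennreal (t powr (r - 1 / Q) * c)) Q"
        using c Q by (subst ennreal_powr_ennreal)
          (auto simp: powr_mult powr_powr \<alpha>_def algebra_simps ennreal_mult'[symmetric])
      also have "\<dots> \<le> ennreal_powr (?g t) Q"
        using Q True f by (intro ennreal_powr_mono) (auto simp: ennreal_mult' intro!: mult_left_mono)
      finally show ?thesis
        using True by simp
    next
      case False
      then show ?thesis
        \<comment> \<open>At \<open>t = 0\<close> the closed indicator on the left is 1 while the
          right side is 0; the inequality survives because \<open>0 powr x = 0\<close>.\<close>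
        by (cases "t = 0") auto
    qed
    have "ennreal ((1 / \<alpha>) powr (1 / Q) * c * a powr r) = ennreal_powr (ennreal (c powr Q * (a powr \<alpha> / \<alpha>))) (1 / Q)"
      using \<alpha> Q c a by (subst ennreal_powr_ennreal) (auto simp: powr_mult powr_powr powr_divide \<alpha>_def)
    also have "ennreal (c powr Q * (a powr \<alpha> / \<alpha>))
        = (\<integral>\<^sup>+ t. ennreal (c powr Q) * (ennreal (t powr (\<alpha> - 1)) * indicator {0..a} t) \<partial>lborel)"
      using \<alpha> a by (simp add: nn_integral_cmult nn_integral_powr_from_0 ennreal_mult'[symmetric])
    also have "ennreal_powr \<dots> (1 / Q) \<le> ennreal_powr (\<integral>\<^sup>+ t\<in>{0<..}. ennreal_powr (?g t) Q \<partial>lborel) (1 / Q)"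
      using Q by (intro ennreal_powr_mono nn_integral_mono *) auto
    finally show "ennreal ((1 / \<alpha>) powr (1 / Q) * c * a powr enn2real (1 / p)) \<le> lorentz_norm M p q f"
      unfolding lorentz_norm_def Lq_norm_def using False Q by (simp add: r_def[symmetric] Q_def[symmetric])
  qed
qed

section \<open>Sufficiency of \<open>p1 < p2\<close>: truncation at a level\<close>

lemma star_embedded_at_infinity_lorentz:
  fixes M :: "'a measure" and p1 p2 q1 q2 :: ennreal
  assumes "p1 < p2"
    and "0 < p1" and "0 < p2" and "0 < q1" and "0 < q2"
    and "p1 < \<infinity> \<or> q1 = \<infinity>" and "p2 < \<infinity> \<or> q2 = \<infinity>"
  shows "star_embedded_at_infinity M
      (lorentz_norm M p1 q1 :: ('a \<Rightarrow> 'b::{real_normed_vector, second_countable_topology}) \<Rightarrow> ennreal)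
      (lorentz_norm M p2 q2)"
proof -
  define r1 where "r1 = enn2real (1 / p1)"
  define r2 where "r2 = enn2real (1 / p2)"
  let ?B = "{f :: 'a \<Rightarrow> 'b. f \<in> borel_measurable M \<and> lorentz_norm M p1 q1 f \<le> 1}"
  let ?S = "\<lambda>a. SUP f\<in>?B. INF E\<in>{E \<in> sets M. emeasure M E \<le> ennreal a}.
    lorentz_norm M p2 q2 (\<lambda>x. indicator (space M - E) x *\<^sub>R f x)"
  have r: "r2 < r1"
    using assms enn2real_inverse_less_iff[of p1 p2] by (simp add: r1_def r2_def)
  obtain K1 where K1: "0 < K1"
    "\<And>(M :: 'a measure) (f :: 'a \<Rightarrow> 'b) c a. 0 \<le> c \<Longrightarrow> 0 < a \<Longrightarrow>
      (\<And>t. 0 < t \<Longrightarrow> t \<le> a \<Longrightarrow> ennreal c \<le> rearrangement M f t) \<Longrightarrow>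
      ennreal (K1 * c * a powr r1) \<le> lorentz_norm M p1 q1 f"
    using lorentz_norm_ge_plateau[of p1 q1] assms unfolding r1_def by metis
  \<comment> \<open>The profile for the target space decays with the exponent \<open>r1\<close> of
    the source space, which is admissible because \<open>r2 < r1\<close>.\<close>
  obtain K2 where K2: "0 < K2"
    "\<And>(M :: 'a measure) (f :: 'a \<Rightarrow> 'b) c a. 0 \<le> c \<Longrightarrow> 0 < a \<Longrightarrow>
      (\<And>t. 0 < t \<Longrightarrow> rearrangement M f t \<le> ennreal (c * min 1 ((t / a) powr (- r1)))) \<Longrightarrow>
      lorentz_norm M p2 q2 f \<le> ennreal (K2 * c * a powr r2)"
    using lorentz_norm_le_profile[of p2 q2 r1] assms r unfolding r2_def by metis
  \<comment> \<open>With this choice a plateau of height \<open>C * t powr (- r1)\<close> up to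
    \<open>t\<close> has source norm at least 2. Exceeding 1 contradicts the unit ball and makes the
    decay bound strict, as \<open>emeasure_superlevel_le\<close> requires.\<close>
  define C where "C = 2 / K1"
  have C: "0 < C" "K1 * C = 2"
    using K1 by (auto simp: C_def)
  have bound: "?S a \<le> ennreal (K2 * C * a powr (r2 - r1))" if a: "0 < a" for a
  proof (rule SUP_least)
    fix f assume "f \<in> ?B"
    then have f [measurable]: "f \<in> borel_measurable M" and norm_f: "lorentz_norm M p1 q1 f \<le> 1"
      by auto
    have decay: "rearrangement M f t < ennreal (C * t powr (- r1))" if t: "0 < t" for t
    proof (rule ccontr)
      assume "\<not> ?thesis"
      then have *: "ennreal (C * t powr (- r1)) \<le> rearrangement M f u" if "u \<le> t" for u
        using rearrangement_antimono[OF that, of M f] by (auto simp: not_less intro: order.trans)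
      have "ennreal (K1 * (C * t powr (- r1)) * t powr r1) \<le> lorentz_norm M p1 q1 f"
        using C t * by (intro K1) auto
      also have "K1 * (C * t powr (- r1)) * t powr r1 = 2"
        using C t by (simp add: powr_minus field_simps)
      finally have "ennreal 2 \<le> 1"
        using norm_f by (rule order.trans)
      then show False
        by simp
    qed
    \<comment> \<open>The decay bound evaluated at \<open>t = a\<close>, so that the superlevel set
      \<open>E\<close> has measure at most \<open>a\<close>.\<close>
    define l where "l = C * a powr (- r1)"
    define E where "E = {x \<in> space M. norm (f x) > l}"
    define g where "g = (\<lambda>x. indicator (space M - E) x *\<^sub>R f x)"
    have l: "0 < l"
      using C a by (simp add: l_def)
    have E: "E \<in> sets M" "emeasure M E \<le> ennreal a"
      using emeasure_superlevel_le[OF f, of a l] decay[OF a] by (auto simp: E_def l_def)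
    \<comment> \<open>The flat bound comes from the truncation, since \<open>norm (g x)\<close>
      never exceeds \<open>l\<close>; the decaying bound is inherited from \<open>f\<close>, because
      \<open>l * (t / a) powr (- r1) = C * t powr (- r1)\<close>.\<close>
    have "rearrangement M g t \<le> ennreal (l * min 1 ((t / a) powr (- r1)))" if t: "0 < t" for t
    proof -
      have "{x \<in> space M. norm (g x) > l} = {}"
        using l by (auto simp: g_def E_def indicator_def)
      then have "emeasure M {x \<in> space M. norm (g x) > l} = 0"
        by (simp only: emeasure_empty)
      then have "rearrangement M g t \<le> ennreal l"
        using l by (intro rearrangement_le) auto
      moreover have "rearrangement M g t \<le> ennreal (l * (t / a) powr (- r1))"
      proof -
        have "rearrangement M g t \<le> rearrangement M f t"
          by (rule rearrangement_mono_norm) (auto simp: g_def indicator_def)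
        also have "\<dots> \<le> ennreal (C * t powr (- r1))"
          using decay[OF t] by simp
        also have "C * t powr (- r1) = l * (t / a) powr (- r1)"
          using t a by (simp add: l_def powr_divide)
        finally show ?thesis .
      qed
      ultimately show ?thesis
        by (simp add: min_def)
    qed
    then have "lorentz_norm M p2 q2 g \<le> ennreal (K2 * l * a powr r2)"
      using l a by (intro K2) auto
    also have "K2 * l * a powr r2 = K2 * C * a powr (r2 - r1)"
      using a by (simp add: l_def powr_diff powr_minus field_simps)
    finally show "(INF E\<in>{E \<in> sets M. emeasure M E \<le> ennreal a}.
        lorentz_norm M p2 q2 (\<lambda>x. indicator (space M - E) x *\<^sub>R f x)) \<le> ennreal (K2 * C * a powr (r2 - r1))"
      using E unfolding g_def by (intro INF_lower2[of E]) auto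
  qed
  have "((\<lambda>a. ennreal (K2 * C * a powr (r2 - r1))) \<longlongrightarrow> ennreal (K2 * C * 0)) at_top"
    using r by (intro tendsto_intros tendsto_ennrealI tendsto_neg_powr filterlim_ident) auto
  then have lim: "((\<lambda>a. ennreal (K2 * C * a powr (r2 - r1))) \<longlongrightarrow> 0) at_top"
    by simp
  show ?thesis
    unfolding star_embedded_at_infinity_def
  proof (rule tendsto_sandwich[OF _ _ tendsto_const lim])
    show "\<forall>\<^sub>F a in at_top. ?S a \<le> ennreal (K2 * C * a powr (r2 - r1))"
      using eventually_gt_at_top[of 0] by eventually_elim (rule bound)
  qed simp
qed

section \<open>Necessity of \<open>p1 < p2\<close>: normalised indicators\<close>

lemma less_if_star_embedded_at_infinity_lorentz:
  fixes M :: "'a measure" and p1 p2 q1 q2 :: ennreal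
  assumes "sigma_finite_measure M" and "emeasure M (space M) = \<infinity>"
    and "0 < p1" and "0 < p2" and "0 < q1" and "0 < q2"
    and "p1 < \<infinity> \<or> q1 = \<infinity>" and "p2 < \<infinity> \<or> q2 = \<infinity>"
    and emb: "star_embedded_at_infinity M
      (lorentz_norm M p1 q1 :: ('a \<Rightarrow> 'b::{real_normed_field, second_countable_topology}) \<Rightarrow> ennreal)
      (lorentz_norm M p2 q2)"
  shows "p1 < p2"
proof (rule ccontr)
  define r1 where "r1 = enn2real (1 / p1)"
  define r2 where "r2 = enn2real (1 / p2)"
  let ?B = "{f :: 'a \<Rightarrow> 'b. f \<in> borel_measurable M \<and> lorentz_norm M p1 q1 f \<le> 1}"
  let ?S = "\<lambda>a. SUP f\<in>?B. INF E\<in>{E \<in> sets M. emeasure M E \<le> ennreal a}.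
    lorentz_norm M p2 q2 (\<lambda>x. indicator (space M - E) x *\<^sub>R f x)"
  assume "\<not> p1 < p2"
  then have r: "r1 \<le> r2"
    using assms enn2real_inverse_less_iff[of p1 p2] unfolding r1_def r2_def by linarith
  \<comment> \<open>The rearrangement of an indicator vanishes from some point on, so any decay
    exponent above \<open>r1\<close> would serve; \<open>r1 + 1\<close> is one.\<close>
  obtain K1 where K1: "0 < K1"
    "\<And>(M :: 'a measure) (f :: 'a \<Rightarrow> 'b) c a. 0 \<le> c \<Longrightarrow> 0 < a \<Longrightarrow>
      (\<And>t. 0 < t \<Longrightarrow> rearrangement M f t \<le> ennreal (c * min 1 ((t / a) powr (- (r1 + 1))))) \<Longrightarrow>
      lorentz_norm M p1 q1 f \<le> ennreal (K1 * c * a powr r1)"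
    using lorentz_norm_le_profile[of p1 q1 "r1 + 1"] assms unfolding r1_def by (metis less_add_one)
  obtain K2 where K2: "0 < K2"
    "\<And>(M :: 'a measure) (f :: 'a \<Rightarrow> 'b) c a. 0 \<le> c \<Longrightarrow> 0 < a \<Longrightarrow>
      (\<And>t. 0 < t \<Longrightarrow> t \<le> a \<Longrightarrow> ennreal c \<le> rearrangement M f t) \<Longrightarrow>
      ennreal (K2 * c * a powr r2) \<le> lorentz_norm M p2 q2 f"
    using lorentz_norm_ge_plateau[of p2 q2] assms unfolding r2_def by metis
  \<comment> \<open>The lower bound found below is
    \<open>K2 * c * (m / 4) powr r2 = \<delta> * m powr (r2 - r1)\<close>, which is at least
    \<open>\<delta>\<close> when \<open>m > 1\<close> and \<open>r1 \<le> r2\<close>.\<close>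
  define \<delta> where "\<delta> = K2 / K1 * (1 / 4) powr r2"
  have "0 < \<delta>"
    using K1 K2 by (simp add: \<delta>_def)
  then have "\<forall>\<^sub>F a in at_top. ?S a < ennreal \<delta>"
    using emb unfolding star_embedded_at_infinity_def by (intro order_tendstoD(2)) auto
  then obtain N where N: "\<And>a. N \<le> a \<Longrightarrow> ?S a < ennreal \<delta>"
    by (auto simp: eventually_at_top_linorder)
  \<comment> \<open>By sigma-finiteness a space of infinite measure has sets of arbitrarily large
    finite measure. The bound 1 makes powers of \<open>m\<close> with nonnegative exponent at least
    1; the bound \<open>2 * N\<close> allows \<open>a = m / 2\<close>.\<close>
  obtain A where A [measurable]: "A \<in> sets M"
    and A_bounds: "emeasure M A < \<infinity>" "ennreal (max 1 (2 * N)) < emeasure M A"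
    using sigma_finite_measure.approx_PInf_emeasure_with_finite[OF assms(1) sets.top assms(2)] by metis
  define m where "m = measure M A"
  have m: "emeasure M A = ennreal m"
    using A_bounds by (simp add: m_def emeasure_eq_ennreal_measure)
  then have m_bounds: "1 < m" "2 * N < m"
    using A_bounds by (auto simp: ennreal_less_iff)
  \<comment> \<open>The height for which the upper estimate \<open>K1 * c * m powr r1\<close> of the
    source norm equals 1.\<close>
  define c where "c = 1 / (K1 * m powr r1)"
  have c: "0 < c"
    using K1 m_bounds by (simp add: c_def)
  define f :: "'a \<Rightarrow> 'b" where "f = (\<lambda>x. indicator A x *\<^sub>R of_real c)"
  have norm_f: "norm (f x) = c * indicator A x" for x
    using c by (simp add: f_def indicator_def)
  have "rearrangement M f t \<le> ennreal (c * min 1 ((t / m) powr (- (r1 + 1))))" if t: "0 < t" for t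
  proof (cases "t < m")
    case True
    have "1 powr (- (r1 + 1)) \<le> (t / m) powr (- (r1 + 1))"
      using True t enn2real_nonneg[of "1 / p1"] by (intro powr_mono2') (auto simp flip: r1_def)
    moreover have "{x \<in> space M. norm (f x) > c} = {}"
      using c by (auto simp: norm_f indicator_def)
    then have "emeasure M {x \<in> space M. norm (f x) > c} = 0"
      by (simp only: emeasure_empty)
    then have "rearrangement M f t \<le> ennreal c"
      using c by (intro rearrangement_le) auto
    ultimately show ?thesis
      by (simp add: min_def)
  next
    case False
    have "{x \<in> space M. norm (f x) > 0} \<subseteq> A"
      by (auto simp: norm_f indicator_def split: if_splits)
    then have "emeasure M {x \<in> space M. norm (f x) > 0} \<le> emeasure M A"
      by (intro emeasure_mono) auto
    also have "\<dots> \<le> ennreal t"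
      using False by (simp add: m ennreal_leI)
    finally have "rearrangement M f t \<le> ennreal 0"
      by (intro rearrangement_le) auto
    then show ?thesis
      by simp
  qed
  then have "lorentz_norm M p1 q1 f \<le> ennreal (K1 * c * m powr r1)"
    using c m_bounds by (intro K1) auto
  also have "K1 * c * m powr r1 = 1"
    using K1 m_bounds by (simp add: c_def)
  finally have f: "f \<in> ?B"
    by (simp add: f_def)
  have "ennreal \<delta> \<le> (INF E\<in>{E \<in> sets M. emeasure M E \<le> ennreal (m / 2)}.
      lorentz_norm M p2 q2 (\<lambda>x. indicator (space M - E) x *\<^sub>R f x))"
  proof (rule INF_greatest)
    fix E assume "E \<in> {E \<in> sets M. emeasure M E \<le> ennreal (m / 2)}"
    then have E [measurable]: "E \<in> sets M" and E_le: "emeasure M E \<le> ennreal (m / 2)"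
      by auto
    define g where "g = (\<lambda>x. indicator (space M - E) x *\<^sub>R f x)"
    \<comment> \<open>At least \<open>m / 2\<close> of \<open>A\<close> remains; settling for
      \<open>m / 4\<close> gives the strict inequality needed in \<open>rearrangement_ge\<close> for
      every \<open>t \<le> m / 4\<close>.\<close>
    have large: "ennreal (m / 4) < emeasure M (A - E)"
    proof (rule ccontr)
      assume "\<not> ?thesis"
      then have "emeasure M (A - E) + emeasure M E \<le> ennreal (m / 4) + ennreal (m / 2)"
        using E_le by (intro add_mono) auto
      also have "\<dots> = ennreal (m / 4 + m / 2)"
        using m_bounds by (subst ennreal_plus) auto
      also have "\<dots> < emeasure M A"
        using m_bounds by (simp add: m ennreal_less_iff)
      also have "\<dots> \<le> emeasure M ((A - E) \<union> E)"
        by (intro emeasure_mono) auto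
      also have "\<dots> \<le> emeasure M (A - E) + emeasure M E"
        by (intro emeasure_subadditive) auto
      finally show False
        by simp
    qed
    have "ennreal c \<le> rearrangement M g t" if "t \<le> m / 4" for t
    proof (rule rearrangement_ge)
      fix l assume l: "0 \<le> l" "l < c"
      have "ennreal t \<le> ennreal (m / 4)"
        using that by (rule ennreal_leI)
      also note large
      also have "A - E = {x \<in> space M. norm (g x) > l}"
        using l sets.sets_into_space[OF A] by (auto simp: g_def norm_f indicator_def split: if_splits)
      finally show "ennreal t < emeasure M {x \<in> space M. norm (g x) > l}" .
    qed
    then have "ennreal (K2 * c * (m / 4) powr r2) \<le> lorentz_norm M p2 q2 g"
      using c m_bounds by (intro K2) auto
    moreover have "\<delta> \<le> K2 * c * (m / 4) powr r2"
    proof -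
      have "\<delta> * 1 \<le> \<delta> * m powr (r2 - r1)"
        using \<open>0 < \<delta>\<close> m_bounds r by (intro mult_left_mono ge_one_powr_ge_zero) auto
      also have "\<dots> = K2 * c * (m / 4) powr r2"
        using m_bounds by (simp add: \<delta>_def c_def powr_diff powr_divide)
      finally show ?thesis
        by simp
    qed
    ultimately show "ennreal \<delta> \<le> lorentz_norm M p2 q2 (\<lambda>x. indicator (space M - E) x *\<^sub>R f x)"
      unfolding g_def by (meson ennreal_leI order.trans)
  qed
  also have "\<dots> \<le> ?S (m / 2)"
    using f by (intro SUP_upper)
  also have "\<dots> < ennreal \<delta>"
    using m_bounds by (intro N) auto
  finally show False
    by simp
qed

theorem proposition6p1:
  fixes M :: "'a measure" and p1 p2 q1 q2 :: ennreal
  assumes "sigma_finite_measure M"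
    and "nonatomic M"
    and "emeasure M (space M) = \<infinity>"
    and "0 < p1" and "0 < p2" and "0 < q1" and "0 < q2"
    and "p1 < \<infinity> \<or> (p1 = \<infinity> \<and> q1 = \<infinity>)"
    and "p2 < \<infinity> \<or> (p2 = \<infinity> \<and> q2 = \<infinity>)"
  shows "star_embedded_at_infinity M
           (lorentz_norm M p1 q1 :: ('a \<Rightarrow> 'b::{real_normed_field, second_countable_topology}) \<Rightarrow> ennreal)
           (lorentz_norm M p2 q2)
         \<longleftrightarrow> p1 < p2"
  using assms star_embedded_at_infinity_lorentz[of p1 p2 q1 q2 M]
    less_if_star_embedded_at_infinity_lorentz[of M p1 p2 q1 q2] by blast

end
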